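(* Let $D$ be the generator of a strongly continuous one-parameter group of isometries $e^{tD}$, $t\in\mathbb{R}$, in a complex Banach space $E$. (i) Suppose $f\in E$ belongs to $\mathbf{B}_\sigma(D)$ for some $0<\sigma<\infty$. Then the limit $$d_f=\lim_{k\to\infty}\|D^kf\|^{1/k}$$ exists and $d_f=\sigma_f$. (ii) Conversely, if $f\in\mathcal{D}^\infty$ and $d_f=\lim_{k\to\infty}\|D^kf\|^{1/k}$ exists and is finite, then $f\in\mathbf{B}_{d_f}(D)$ and $d_f=\sigma_f$.
   Context: $\mathcal{D}^k$ denotes the domain of $D^k$ and $\mathcal{D}^\infty=\bigcap_{k\in\mathbb{N}}\mathcal{D}^k$. For $\sigma\ge 0$, $\mathbf{B}_\sigma(D)$ is the set of all $f\in\mathcal{D}^\infty$ such that $\|D^kf\|\le\sigma^k\|f\|$ for all $k\in\mathbb{N}=\{1,2,\dots\}$. For $f\in E$, $\sigma_f$ denotes the smallest finite real number $\sigma_f\ge 0$ such that $f\in\mathcal{D}^\infty$ and $\|D^kf\|\le\sigma_f^k\|f\|$ for all $k\in\mathbb{N}$; if there is no such number, $\sigma_f=\infty$. *)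

theory Defs
  imports Complex_Main "HOL-Library.Extended_Real"
begin

class complex_banach = banach +
  fixes scaleC :: "complex \<Rightarrow> 'a \<Rightarrow> 'a"  (infixr \<open>*\<^sub>C\<close> 75)
  assumes scaleC_add_right: "a *\<^sub>C (x + y) = a *\<^sub>C x + a *\<^sub>C y"
    and scaleC_add_left: "(a + b) *\<^sub>C x = a *\<^sub>C x + b *\<^sub>C x"
    and scaleC_scaleC: "a *\<^sub>C b *\<^sub>C x = (a * b) *\<^sub>C x"
    and scaleR_scaleC: "r *\<^sub>R x = complex_of_real r *\<^sub>C x"
    and norm_scaleC: "norm (a *\<^sub>C x) = cmod a * norm x"

definition strongly_continuous_isometry_group ::
    "(real \<Rightarrow> 'a::complex_banach \<Rightarrow> 'a) \<Rightarrow> bool" where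
  "strongly_continuous_isometry_group T \<longleftrightarrow>
     (\<forall>t. Vector_Spaces.linear scaleC scaleC (T t)) \<and>
     (\<forall>t x. norm (T t x) = norm x) \<and>
     (\<forall>x. T 0 x = x) \<and>
     (\<forall>s t x. T (s + t) x = T s (T t x)) \<and>
     (\<forall>x. continuous_on UNIV (\<lambda>t. T t x))"

text \<open>An unbounded operator is a domain \<open>A\<close> together with a function \<open>D\<close> whose values outside
  \<open>A\<close> are irrelevant.\<close>

definition is_generator ::
    "(real \<Rightarrow> 'a::complex_banach \<Rightarrow> 'a) \<Rightarrow> 'a set \<Rightarrow> ('a \<Rightarrow> 'a) \<Rightarrow> bool" where
  "is_generator T A D \<longleftrightarrow>
     A = {x. \<exists>y. ((\<lambda>t. (T t x - x) /\<^sub>R t) \<longlongrightarrow> y) (at 0)} \<and>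
     (\<forall>x\<in>A. ((\<lambda>t. (T t x - x) /\<^sub>R t) \<longlongrightarrow> D x) (at 0))"

primrec power_domain :: "'a set \<Rightarrow> ('a \<Rightarrow> 'a) \<Rightarrow> nat \<Rightarrow> 'a set" where
  "power_domain A D 0 = UNIV"
| "power_domain A D (Suc k) = {x \<in> A. D x \<in> power_domain A D k}"

definition smooth_domain :: "'a set \<Rightarrow> ('a \<Rightarrow> 'a) \<Rightarrow> 'a set" where
  "smooth_domain A D = (\<Inter>k\<in>{1..}. power_domain A D k)"

definition bernstein_set :: "'a::complex_banach set \<Rightarrow> ('a \<Rightarrow> 'a) \<Rightarrow> real \<Rightarrow> 'a set" where
  "bernstein_set A D \<sigma> =
     {f \<in> smooth_domain A D. \<forall>k\<ge>1. norm ((D ^^ k) f) \<le> \<sigma> ^ k * norm f}"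

definition bernstein_exponent :: "'a::complex_banach set \<Rightarrow> ('a \<Rightarrow> 'a) \<Rightarrow> 'a \<Rightarrow> ereal" where
  "bernstein_exponent A D f =
     (let P = (\<lambda>\<sigma>::real. \<sigma> \<ge> 0 \<and> f \<in> bernstein_set A D \<sigma>)
      in if \<exists>s. P s \<and> (\<forall>r. P r \<longrightarrow> s \<le> r) then ereal (LEAST s. P s) else \<infinity>)"

end

theory Submission imports Defs "HOL-Complex_Analysis.Complex_Analysis" begin

text \<open>Everything follows from one inequality: if \<open>\<parallel>D\<^sup>m f\<parallel> \<le> B q\<^sup>m\<close> for infinitely many \<open>m\<close>, then
  \<open>\<parallel>D f\<parallel> \<le> q \<parallel>f\<parallel>\<close>. Applied to all \<open>D\<^sup>k f\<close> it bounds \<open>\<parallel>D\<^sup>k f\<parallel>\<close> by \<open>d\<^sup>k \<parallel>f\<parallel>\<close>, where \<open>d\<close> is the lower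
  limit of the roots, so that the roots converge to \<open>d\<close> and no smaller number serves as a bound.

  For the inequality, a norming functional \<open>\<phi>\<close> reduces the claim to the real function
  \<open>F t = \<phi> (e\<^sup>t\<^sup>D f) / \<parallel>f\<parallel>\<close>, which is bounded by 1. The partial sums of the Laurent series at infinity
  of its Laplace transform are controlled on the circle of radius \<open>q\<close>, whence
  \<open>\<bar>F\<^sup>(\<^sup>k\<^sup>)\<bar> = O(k q\<^sup>k)\<close> for all \<open>k\<close>. So \<open>F\<close> extends to an entire function \<open>h\<close> which, for each \<open>r > q\<close>, is
  \<open>O(exp (r \<bar>Im w\<bar>))\<close>. The maximum principle for the functions \<open>T\<^sub>n \<circ> h\<close>, with Chebyshev polynomials
  \<open>T\<^sub>n\<close>, gives \<open>\<bar>Im (h (\<i>y))\<bar> \<le> sinh (r y)\<close>; divide by \<open>y\<close> and let \<open>y\<close> tend to 0.\<close>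

subsection \<open>Norming functionals\<close>

definition sublinear :: "('a::real_vector \<Rightarrow> real) \<Rightarrow> bool" where
  "sublinear p \<longleftrightarrow> (\<forall>x y. p (x + y) \<le> p x + p y) \<and> (\<forall>c x. 0 \<le> c \<longrightarrow> p (c *\<^sub>R x) = c * p x)"

text \<open>One inequality for \<open>c > 0\<close> is enough: used with \<open>1 / c\<close> at the
  point \<open>c *\<^sub>R x\<close>, it yields the reverse one.\<close>

lemma sublinearI:
  assumes "\<And>x y. p (x + y) \<le> p x + p y" and "p 0 = 0"
    and "\<And>c x. 0 < c \<Longrightarrow> p (c *\<^sub>R x) \<le> c * p x"
  shows "sublinear p"
proof -
  have "p (c *\<^sub>R x) = c * p x" if "0 \<le> c" for c x
  proof (cases "c = 0")
    case False
    with that have c: "0 < c" by simp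
    have "p ((1 / c) *\<^sub>R (c *\<^sub>R x)) \<le> (1 / c) * p (c *\<^sub>R x)"
      using assms(3)[of "1 / c" "c *\<^sub>R x"] c by simp
    then have "c * p x \<le> p (c *\<^sub>R x)"
      using c by (simp add: field_simps)
    with assms(3)[OF c] show ?thesis by (simp add: order_antisym)
  qed (simp add: assms(2))
  with assms(1) show ?thesis by (simp add: sublinear_def)
qed

lemma sublinear_add: "sublinear p \<Longrightarrow> p (x + y) \<le> p x + p y"
  by (simp add: sublinear_def)

lemma sublinear_scale: "sublinear p \<Longrightarrow> 0 \<le> c \<Longrightarrow> p (c *\<^sub>R x) = c * p x"
  by (simp add: sublinear_def)

lemma sublinear_zero: "sublinear p \<Longrightarrow> p 0 = 0"
  using sublinear_scale[of p 0 0] by simp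

lemma sublinear_lower: "sublinear p \<Longrightarrow> - p (- x) \<le> p x"
  using sublinear_add[of p x "- x"] sublinear_zero[of p] by simp

text \<open>The functional is the infimum over \<open>t \<ge> 0\<close> of
  \<open>p (x + t *\<^sub>R a) - t * p a\<close>; the terms \<open>t = 0\<close> and
  \<open>t = 1\<close> give the two bounds.\<close>

lemma sublinear_decrease:
  assumes p: "sublinear p"
  obtains q where "sublinear q" "\<And>x. q x \<le> p x" "\<And>x. q x \<le> p (x + a) - p a"
proof
  define g where "g x t = p (x + t *\<^sub>R a) - t * p a" for x t
  define q where "q x = (INF t\<in>{0..}. g x t)" for x
  \<comment> \<open>A lower bound independent of \<open>t\<close> makes the real infimum
    meaningful.\<close>
  have low: "- p (- x) \<le> g x t" if "0 \<le> t" for x t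
    using sublinear_add[OF p, of "x + t *\<^sub>R a" "- x"] sublinear_scale[OF p that, of a]
    by (simp add: g_def)
  have le: "q x \<le> g x t" if "0 \<le> t" for x t
    unfolding q_def using that low by (intro cINF_lower bdd_belowI2) auto
  have ge: "c \<le> q x" if "\<And>t. 0 \<le> t \<Longrightarrow> c \<le> g x t" for x c
    unfolding q_def using that by (intro cINF_greatest) auto
  show "sublinear q"
  proof (rule sublinearI)
    show "q (x + y) \<le> q x + q y" for x y
    proof -
      \<comment> \<open>With \<open>s\<close> and \<open>t\<close> independent, the two infima can
        be taken one after the other.\<close>
      have "q (x + y) - g x s \<le> g y t" if "0 \<le> s" "0 \<le> t" for s t
      proof -
        have "q (x + y) \<le> g (x + y) (s + t)" using that by (intro le) simp
        also have "\<dots> \<le> g x s + g y t"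
          using sublinear_add[OF p, of "x + s *\<^sub>R a" "y + t *\<^sub>R a"]
          by (simp add: g_def algebra_simps)
        finally show ?thesis by simp
      qed
      then have "q (x + y) - g x s \<le> q y" if "0 \<le> s" for s
        using that by (intro ge)
      then have "q (x + y) - q y \<le> q x"
        by (intro ge) (simp add: algebra_simps)
      then show ?thesis by simp
    qed
    show "q 0 = 0"
    proof (rule order_antisym)
      show "q 0 \<le> 0" using le[of 0 0] by (simp add: g_def sublinear_zero[OF p])
      show "0 \<le> q 0" by (rule ge) (simp add: g_def sublinear_scale[OF p])
    qed
    show "q (c *\<^sub>R x) \<le> c * q x" if c: "0 < c" for c x
    proof -
      have "q (c *\<^sub>R x) / c \<le> g x t" if "0 \<le> t" for t
      proof -
        have "q (c *\<^sub>R x) \<le> g (c *\<^sub>R x) (c * t)" using c that by (intro le) simp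
        also have "\<dots> = c * g x t"
          using sublinear_scale[OF p, of c "x + t *\<^sub>R a"] c by (simp add: g_def algebra_simps)
        finally show ?thesis using c by (simp add: field_simps)
      qed
      then have "q (c *\<^sub>R x) / c \<le> q x" by (rule ge)
      then show ?thesis using c by (simp add: field_simps)
    qed
  qed
  show "q x \<le> p x" for x using le[of 0 x] by (simp add: g_def)
  show "q x \<le> p (x + a) - p a" for x using le[of 1 x] by (simp add: g_def)
qed

text \<open>This supplies the lower bounds that Zorn's lemma asks for. Subadditivity survives the
  infimum because of any two members of a chain, the smaller one lies below both.\<close>

lemma sublinear_Inf_chain:
  assumes "C \<noteq> {}" and sub: "\<And>q. q \<in> C \<Longrightarrow> sublinear q"
    and le: "\<And>q x. q \<in> C \<Longrightarrow> q x \<le> p x"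
    and chain: "\<And>q r. q \<in> C \<Longrightarrow> r \<in> C \<Longrightarrow> q \<le> r \<or> r \<le> q"
  shows "sublinear (\<lambda>x. INF q\<in>C. q x)" and "q \<in> C \<Longrightarrow> (INF q\<in>C. q x) \<le> q x"
proof -
  define u where "u x = (INF q\<in>C. q x)" for x
  have low: "- p (- x) \<le> q x" if "q \<in> C" for q x
    using sublinear_lower[OF sub[OF that], of x] le[OF that, of "- x"] by simp
  have lo: "u x \<le> q x" if "q \<in> C" for q x
    unfolding u_def using low that by (intro cINF_lower bdd_belowI2) auto
  have ge: "c \<le> u x" if "\<And>q. q \<in> C \<Longrightarrow> c \<le> q x" for c x
    unfolding u_def using that \<open>C \<noteq> {}\<close> by (intro cINF_greatest) auto
  have "sublinear u"
  proof (rule sublinearI)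
    show "u (x + y) \<le> u x + u y" for x y
    proof -
      have *: "u (x + y) - q x \<le> r y" if qr: "q \<in> C" "r \<in> C" for q r
      proof -
        from chain[OF qr] obtain s where s: "s \<in> C" "s \<le> q" "s \<le> r"
          using qr by blast
        have "u (x + y) \<le> s x + s y"
          using lo[OF s(1), of "x + y"] sublinear_add[OF sub[OF s(1)], of x y] by simp
        also have "\<dots> \<le> q x + r y" using s(2,3) by (intro add_mono) (auto dest: le_funD)
        finally show ?thesis by simp
      qed
      have "u (x + y) - q x \<le> u y" if "q \<in> C" for q
        using * that by (intro ge)
      then have "u (x + y) - u y \<le> u x"
        by (intro ge) (simp add: algebra_simps)
      then show ?thesis by simp
    qed
    show "u 0 = 0"
      using \<open>C \<noteq> {}\<close> sub by (simp add: u_def sublinear_zero)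
    show "u (c *\<^sub>R x) \<le> c * u x" if c: "0 < c" for c x
    proof -
      have "u (c *\<^sub>R x) / c \<le> u x"
        using lo[of _ "c *\<^sub>R x"] c sublinear_scale[OF sub]
        by (intro ge) (simp add: field_simps)
      then show ?thesis using c by (simp add: field_simps)
    qed
  qed
  then show "sublinear (\<lambda>x. INF q\<in>C. q x)" by (simp add: u_def[abs_def])
  show "q \<in> C \<Longrightarrow> (INF q\<in>C. q x) \<le> q x" using lo by (simp add: u_def)
qed

text \<open>A minimal sublinear functional is linear: \<open>sublinear_decrease\<close> cannot lower it, which
  gives superadditivity.\<close>

lemma Hahn_Banach_sublinear:
  fixes p :: "'a::real_vector \<Rightarrow> real"
  assumes p: "sublinear p"
  obtains \<phi> where "linear \<phi>" "\<And>x. \<phi> x \<le> p x" "\<phi> y = p y"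
proof -
  \<comment> \<open>Lowering \<open>p\<close> once along \<open>y\<close> gives
    \<open>p1 (- y) \<le> p 0 - p y = - p y\<close>. Every linear functional below \<open>p1\<close>
    therefore has value at least \<open>p y\<close> at \<open>y\<close>.\<close>
  obtain p1 where p1: "sublinear p1" "\<And>x. p1 x \<le> p x" "\<And>x. p1 x \<le> p (x + y) - p y"
    using sublinear_decrease[OF p] by metis
  define A where "A = {q. sublinear q \<and> q \<le> p1}"
  \<comment> \<open>The order is reversed, so that the maximal element from Zorn's lemma is a
    minimal functional.\<close>
  have po: "partial_order_on A (relation_of (\<lambda>q r. r \<le> q) A)"
    by (rule partial_order_on_relation_ofI) auto
  have "\<exists>m\<in>A. \<forall>q\<in>A. q \<le> m \<longrightarrow> q = m"
  proof (rule predicate_Zorn[OF po])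
    fix C assume C: "C \<in> Chains (relation_of (\<lambda>q r. r \<le> q) A)"
    then have CA: "C \<subseteq> A" and tot: "\<And>q r. q \<in> C \<Longrightarrow> r \<in> C \<Longrightarrow> q \<le> r \<or> r \<le> q"
      by (auto simp: Chains_def relation_of_def)
    show "\<exists>u\<in>A. \<forall>q\<in>C. u \<le> q"
    proof (cases "C = {}")
      case True
      then show ?thesis using p1(1) by (auto simp: A_def)
    next
      case False
      have 1: "\<And>q. q \<in> C \<Longrightarrow> sublinear q" and 2: "\<And>q x. q \<in> C \<Longrightarrow> q x \<le> p1 x"
        using CA by (auto simp: A_def le_fun_def)
      have u: "sublinear (\<lambda>x. INF q\<in>C. q x)" "\<And>q x. q \<in> C \<Longrightarrow> (INF q\<in>C. q x) \<le> q x"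
        by (rule sublinear_Inf_chain[where p = p1]; use False 1 2 tot in blast)+
      have "(\<lambda>x. INF q\<in>C. q x) \<le> p1"
        using False u(2) 2 by (fastforce simp: le_fun_def intro: order_trans)
      with u show ?thesis
        by (intro bexI[of _ "\<lambda>x. INF q\<in>C. q x"]) (auto simp: A_def le_fun_def)
    qed
  qed
  then obtain m where m: "sublinear m" "m \<le> p1" and min: "\<And>q. q \<in> A \<Longrightarrow> q \<le> m \<Longrightarrow> q = m"
    by (auto simp: A_def)
  have add: "m (x + a) = m x + m a" for x a
  proof -
    obtain q where q: "sublinear q" "\<And>x. q x \<le> m x" "\<And>x. q x \<le> m (x + a) - m a"
      using sublinear_decrease[OF m(1)] by metis
    have "q = m"
      using q(1,2) m(2) by (intro min) (auto simp: A_def le_fun_def intro: order_trans)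
    then have "m x + m a \<le> m (x + a)" using q(3)[of x] by simp
    with sublinear_add[OF m(1), of x a] show ?thesis by simp
  qed
  have neg: "m (- x) = - m x" for x
    using add[of x "- x"] sublinear_zero[OF m(1)] by simp
  have "m (c *\<^sub>R x) = c * m x" for c x
  proof (cases "0 \<le> c")
    case False
    then show ?thesis
      using sublinear_scale[OF m(1), of "- c" "- x"] neg by simp
  qed (rule sublinear_scale[OF m(1)])
  then have "linear m" by (intro linearI) (auto simp: add)
  moreover have le: "m x \<le> p x" for x
    using m(2) p1(2)[of x] by (auto simp: le_fun_def intro: order_trans)
  moreover have "m y = p y"
  proof -
    have "- m y \<le> - p y"
      using le_funD[OF m(2), of "- y"] p1(3)[of "- y"] neg[of y] sublinear_zero[OF p] by simp
    with le[of y] show ?thesis by simp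
  qed
  ultimately show ?thesis by (rule that)
qed

text \<open>Hahn-Banach with the norm as the dominating functional. Real linearity suffices, as the
  functional only serves to turn an orbit into a real function of time.\<close>

lemma norming_functional:
  fixes y :: "'a::real_normed_vector"
  obtains \<phi> where "bounded_linear \<phi>" "\<And>x. \<bar>\<phi> x\<bar> \<le> norm x" "\<phi> y = norm y"
proof -
  have "sublinear (norm :: 'a \<Rightarrow> real)"
    by (intro sublinearI) (auto simp: norm_triangle_ineq)
  from Hahn_Banach_sublinear[OF this, of y] obtain \<phi> where
    \<phi>: "linear \<phi>" "\<And>x. \<phi> x \<le> norm x" "\<phi> y = norm y" by metis
  have abs: "\<bar>\<phi> x\<bar> \<le> norm x" for x
    using \<phi>(2)[of x] \<phi>(2)[of "- x"] linear_neg[OF \<phi>(1), of x] by simp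
  have "bounded_linear \<phi>"
    by (rule bounded_linear_intro[of \<phi> 1])
       (use \<phi>(1) abs in \<open>auto simp: linear_add linear_cmul\<close>)
  from that[OF this abs \<phi>(3)] show ?thesis .
qed

subsection \<open>Functions with sparsely bounded derivatives\<close>

text \<open>Cauchy's estimate at 0, with radius 1.\<close>

lemma poly_coeff_bound_unit_circle:
  fixes P :: "complex poly"
  assumes "\<And>v. norm v = 1 \<Longrightarrow> norm (poly P v) \<le> B"
  shows "norm (coeff P k) \<le> B"
proof -
  have deriv: "(deriv ^^ k) (poly P) = poly ((pderiv ^^ k) P)"
  proof (induction k)
    case (Suc k)
    show ?case
      by (simp add: Suc) (rule ext, rule DERIV_imp_deriv, rule poly_DERIV)
  qed simp
  have "norm ((deriv ^^ k) (poly P) 0) \<le> fact k * B / 1 ^ k"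
    by (rule Cauchy_inequality) (auto intro!: holomorphic_intros continuous_intros assms)
  moreover have "(deriv ^^ k) (poly P) 0 = fact k * coeff P k"
    by (simp add: deriv poly_0_coeff_0 coeff_higher_pderiv pochhammer_fact)
  ultimately show ?thesis by (simp add: norm_mult)
qed

text \<open>Integrating by parts \<open>m\<close> times shows that the sum equals the integral of
  \<open>exp (- z * t) * (F 0 t - F m t / z ^ m)\<close> over the positive half-line.\<close>

lemma Laplace_partial_sum_bound_right:
  fixes F :: "nat \<Rightarrow> real \<Rightarrow> real"
  assumes deriv: "\<And>k x. (F k has_real_derivative F (Suc k) x) (at x)"
    and bdd: "\<And>k x. \<bar>F k x\<bar> \<le> M k"
    and z: "0 < Re z"
  shows "norm (\<Sum>k<m. of_real (F k 0) / z ^ Suc k) \<le> (M 0 + M m / norm z ^ m) / Re z"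
proof -
  have z0: "z \<noteq> 0" using z by auto
  define a where "a = Re z"
  define c where "c = M 0 + M m / norm z ^ m"
  \<comment> \<open>An antiderivative takes the place of the integral: \<open>Y 0\<close> is the sum
    in question, \<open>Y\<close> tends to 0 at infinity, and its derivative telescopes to the two
    end terms in \<open>Y'\<close>.\<close>
  define Y where "Y t = exp (- z * of_real t) * (\<Sum>k<m. of_real (F k t) / z ^ Suc k)" for t :: real
  define Y' where "Y' t = exp (- z * of_real t) * (of_real (F m t) / z ^ m - of_real (F 0 t))"
    for t :: real
  have tel: "(\<Sum>k<m. of_real (F (Suc k) t) / z ^ Suc k) - z * (\<Sum>k<m. of_real (F k t) / z ^ Suc k)
      = of_real (F m t) / z ^ m - of_real (F 0 t)" for t
  proof (induction m)
    case (Suc m)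
    then show ?case using z0 by (simp add: algebra_simps)
  qed simp
  have dF: "((\<lambda>t. complex_of_real (F k t)) has_vector_derivative of_real (F (Suc k) t)) (at t)" for k t
    using deriv[of k t] by (intro has_vector_derivative_of_real) (simp add: has_real_derivative_iff_has_vector_derivative)
  have dE: "((\<lambda>t. exp (- z * complex_of_real t)) has_vector_derivative - z * exp (- z * of_real t)) (at t)" for t
    by (rule has_vector_derivative_real_field) (auto intro!: derivative_eq_intros)
  have dY: "(Y has_vector_derivative Y' t) (at t)" for t
  proof -
    have "(Y has_vector_derivative
       exp (- z * of_real t) * (\<Sum>k<m. of_real (F (Suc k) t) / z ^ Suc k)
       + (- z * exp (- z * of_real t)) * (\<Sum>k<m. of_real (F k t) / z ^ Suc k)) (at t)"
      unfolding Y_def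
      by (intro has_vector_derivative_mult dE has_vector_derivative_sum
            has_vector_derivative_divide dF)
    also have "exp (- z * of_real t) * (\<Sum>k<m. of_real (F (Suc k) t) / z ^ Suc k)
       + (- z * exp (- z * of_real t)) * (\<Sum>k<m. of_real (F k t) / z ^ Suc k) = Y' t"
      unfolding Y'_def tel[symmetric] by (simp add: algebra_simps)
    finally show ?thesis .
  qed
  have nE: "norm (exp (- z * of_real t)) = exp (- a * t)" for t
    by (simp add: a_def norm_exp_eq_Re)
  have bY': "norm (Y' t) \<le> c * exp (- a * t)" for t
  proof -
    have "norm (of_real (F m t) / z ^ m - of_real (F 0 t)) \<le> \<bar>F m t\<bar> / norm z ^ m + \<bar>F 0 t\<bar>"
      by (rule order_trans[OF norm_triangle_ineq4]) (simp add: norm_divide norm_power)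
    also have "\<dots> \<le> c"
      unfolding c_def using bdd[of m t] bdd[of 0 t] by (auto intro!: add_mono divide_right_mono simp: add.commute)
    finally show ?thesis
      unfolding Y'_def norm_mult nE by (simp add: mult.commute mult_right_mono)
  qed
  define S where "S = (\<Sum>k<m. M k / norm z ^ Suc k)"
  have bY: "norm (Y t) \<le> exp (- a * t) * S" for t
  proof -
    have "norm (\<Sum>k<m. of_real (F k t) / z ^ Suc k) \<le> S"
      unfolding S_def
      by (rule sum_norm_le) (auto simp: norm_divide norm_power norm_mult intro!: divide_right_mono bdd)
    then show ?thesis unfolding Y_def norm_mult nE by (intro mult_left_mono) auto
  qed
  have a: "0 < a" using z by (simp add: a_def)
  \<comment> \<open>Mean value inequality on \<open>{0..t}\<close>:
    \<open>- c / a * exp (- a * t)\<close> is an antiderivative of the bound for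
    \<open>norm (Y' t)\<close>. Afterwards \<open>t\<close> tends to infinity.\<close>
  have main: "norm (Y 0) \<le> exp (- a * t) * S + (c / a - c / a * exp (- a * t))" if "0 < t" for t
  proof -
    have "norm (Y t - Y 0) \<le> (- c / a * exp (- a * t)) - (- c / a * exp (- a * 0))"
    proof (rule differentiable_bound_general[OF that])
      show "continuous_on {0..t} Y"
        using dY by (intro continuous_at_imp_continuous_on ballI) (rule has_vector_derivative_continuous)
      show "continuous_on {0..t} (\<lambda>t. - c / a * exp (- a * t))"
        by (intro continuous_intros)
      show "((\<lambda>t. - c / a * exp (- a * t)) has_vector_derivative c * exp (- a * x)) (at x)" for x
        unfolding has_real_derivative_iff_has_vector_derivative[symmetric]
        using a by (auto intro!: derivative_eq_intros)
    qed (use dY bY' in auto)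
    moreover have "norm (Y 0) \<le> norm (Y t) + norm (Y t - Y 0)"
      by (metis norm_minus_commute norm_triangle_sub)
    ultimately show ?thesis using bY[of t] by simp
  qed
  have "((\<lambda>t. exp (- a * t) * S + (c / a - c / a * exp (- a * t))) \<longlongrightarrow> 0 * S + (c / a - c / a * 0)) at_top"
  proof -
    have "((\<lambda>t. exp (- a * t)) \<longlongrightarrow> 0) at_top"
      using a by real_asymp
    then show ?thesis by (intro tendsto_intros)
  qed
  then have "norm (Y 0) \<le> 0 * S + (c / a - c / a * 0)"
    by (rule tendsto_lowerbound[OF _ eventually_mono[OF eventually_gt_at_top[of 0] main]]) simp_all
  then show ?thesis by (simp add: Y_def c_def a_def)
qed

text \<open>The left half-plane reduces to the right one by the reflection of time, which replaces
  \<open>z\<close> by \<open>- z\<close>.\<close>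

lemma Laplace_partial_sum_bound:
  fixes F :: "nat \<Rightarrow> real \<Rightarrow> real"
  assumes deriv: "\<And>k x. (F k has_real_derivative F (Suc k) x) (at x)"
    and bdd: "\<And>k x. \<bar>F k x\<bar> \<le> M k"
    and z: "Re z \<noteq> 0"
  shows "norm (\<Sum>k<m. of_real (F k 0) / z ^ Suc k) \<le> (M 0 + M m / norm z ^ m) / \<bar>Re z\<bar>"
proof (cases "0 < Re z")
  case True
  then show ?thesis
    using Laplace_partial_sum_bound_right[of F M z m] deriv bdd by simp
next
  case False
  define G where "G k x = (- 1) ^ k * F k (- x)" for k x
  have "norm (\<Sum>k<m. of_real (G k 0) / (- z) ^ Suc k) \<le> (M 0 + M m / norm (- z) ^ m) / Re (- z)"
  proof (rule Laplace_partial_sum_bound_right)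
    show "(G k has_real_derivative G (Suc k) x) (at x)" for k x
      unfolding G_def
      by (rule derivative_eq_intros refl DERIV_chain2[OF deriv])+ simp
  qed (use False z bdd in \<open>auto simp: G_def abs_mult power_abs\<close>)
  also have "(\<Sum>k<m. of_real (G k 0) / (- z) ^ Suc k) = - (\<Sum>k<m. of_real (F k 0) / z ^ Suc k)"
    unfolding sum_negf[symmetric]
    by (intro sum.cong refl) (auto simp: G_def power_minus[of z] field_simps uminus_power_if)
  finally show ?thesis using False by simp
qed

text \<open>The bound of the previous lemma blows up at the imaginary axis like \<open>1 / \<bar>Re z\<bar>\<close>; on the
  circle \<open>\<bar>z\<bar> = q\<close> the factor \<open>1 + v\<^sup>2\<close>, \<open>v = q / z\<close>, compensates for this exactly.\<close>

lemma derivative_bound_of_sparse: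
  fixes F :: "nat \<Rightarrow> real \<Rightarrow> real"
  assumes deriv: "\<And>k x. (F k has_real_derivative F (Suc k) x) (at x)"
    and bdd: "\<And>k x. \<bar>F k x\<bar> \<le> M k"
    and q: "0 < q" and sparse: "\<exists>\<^sub>F m in sequentially. M m \<le> B * q ^ m"
  shows "\<bar>F k x\<bar> \<le> 2 * (M 0 + B) * (k + 1) * q ^ k"
proof -
  define b where "b k = F k x / q ^ k" for k
  have M0: "0 \<le> M k" for k using bdd[of k 0] by simp
  have step: "\<bar>b k + (if 2 \<le> k then b (k - 2) else 0)\<bar> \<le> 2 * (M 0 + B)" for k
  proof -
    \<comment> \<open>Any \<open>m > k\<close> will do: cutting the series at \<open>m\<close>
      leaves the coefficients of index \<open>k\<close> and \<open>k - 2\<close> untouched.\<close>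
    obtain m where m: "m > k" "M m \<le> B * q ^ m"
      using sparse[unfolded frequently_sequentially, rule_format, of "Suc k"]
      by (auto simp: Suc_le_eq)
    have "0 \<le> B * q ^ m" using m M0[of m] by simp
    then have B: "0 \<le> B" using zero_less_power[OF q, of m] by (auto simp: zero_le_mult_iff)
    \<comment> \<open>In the variable \<open>v = q / z\<close> the partial sum becomes
      \<open>v / q * poly P v\<close>, and the circle of radius \<open>q\<close> becomes the unit
      circle.\<close>
    define P where "P = (\<Sum>j<m. monom (complex_of_real (b j)) j)"
    have coeffP: "coeff P j = (if j < m then of_real (b j) else 0)" for j
      by (simp add: P_def coeff_sum coeff_monom)
    have bound: "norm (poly P v) * \<bar>Re v\<bar> \<le> M 0 + B" if v: "norm v = 1" "Re v \<noteq> 0" for v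
    proof -
      define z where "z = of_real q / v"
      have v0: "v \<noteq> 0" using v by auto
      have nz: "norm z = q" using q v by (simp add: z_def norm_divide)
      have "Re (1 / v) = Re v"
        using v by (simp add: Re_divide cmod_def power2_eq_square[symmetric])
      moreover have "z = q *\<^sub>R (1 / v)" by (simp add: z_def scaleR_conv_of_real)
      ultimately have Rez: "Re z = q * Re v" by simp
      define G where "G k t = F k (x + t)" for k t
      have "norm (\<Sum>k<m. of_real (G k 0) / z ^ Suc k) \<le> (M 0 + M m / norm z ^ m) / \<bar>Re z\<bar>"
      proof (rule Laplace_partial_sum_bound)
        show "(G k has_real_derivative G (Suc k) t) (at t)" for k t
          unfolding G_def using DERIV_shift[of "F k" "F (Suc k) (x + t)" t x] deriv[of k "x + t"]
          by (simp add: add.commute)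
      qed (use bdd Rez v q in \<open>auto simp: G_def\<close>)
      also have "(\<Sum>k<m. of_real (G k 0) / z ^ Suc k) = v / of_real q * poly P v"
        unfolding P_def poly_sum sum_distrib_left
        using q v0 by (intro sum.cong refl)
          (simp add: G_def b_def poly_monom z_def field_simps power_divide)
      also have "norm \<dots> = norm (poly P v) / q"
        using v q by (simp add: norm_mult norm_divide)
      finally have "norm (poly P v) * \<bar>Re v\<bar> \<le> M 0 + M m / q ^ m"
        using q v unfolding Rez nz by (simp add: field_simps abs_mult)
      also have "\<dots> \<le> M 0 + B" using m q by (simp add: field_simps)
      finally show ?thesis .
    qed
    have "norm (coeff (P * [:1, 0, 1:]) k) \<le> 2 * (M 0 + B)"
    proof (rule poly_coeff_bound_unit_circle)
      fix v :: complex assume v: "norm v = 1"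
      have "1 + v * v = v * (cnj v + v)"
        using v complex_norm_square[of v] by (simp add: algebra_simps)
      also have "cnj v + v = of_real (2 * Re v)"
        using complex_add_cnj[of v] by (simp add: add.commute)
      finally have "norm (1 + v * v) = 2 * \<bar>Re v\<bar>"
        using v by (simp add: norm_mult)
      moreover have "poly (P * [:1, 0, 1:]) v = poly P v * (1 + v * v)" by (simp add: algebra_simps)
      ultimately have "norm (poly (P * [:1, 0, 1:]) v) = 2 * (norm (poly P v) * \<bar>Re v\<bar>)"
        by (simp only: norm_mult)
      also have "\<dots> \<le> 2 * (M 0 + B)"
        using bound[OF v] M0[of 0] B by (cases "Re v = 0") auto
      finally show "norm (poly (P * [:1, 0, 1:]) v) \<le> 2 * (M 0 + B)" .
    qed
    moreover have "coeff (P * [:1, 0, 1:]) k = of_real (b k + (if 2 \<le> k then b (k - 2) else 0))"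
      using m(1) by (auto simp: coeffP coeff_pCons split: nat.splits)
    ultimately show ?thesis by (simp only: norm_of_real)
  qed
  \<comment> \<open>Each descent by 2 costs another \<open>2 * (M 0 + B)\<close>, hence growth at
    most linear in \<open>k\<close>.\<close>
  have "\<bar>b k\<bar> \<le> 2 * (M 0 + B) * (k + 1)"
  proof (induction k rule: less_induct)
    case (less k)
    show ?case
    proof (cases "2 \<le> k")
      case True
      have "\<bar>b k\<bar> \<le> 2 * (M 0 + B) + \<bar>b (k - 2)\<bar>" using step[of k] True by simp
      also have "\<bar>b (k - 2)\<bar> \<le> 2 * (M 0 + B) * (real (k - 2) + 1)"
        using less[of "k - 2"] True by simp
      also have "2 * (M 0 + B) + \<dots> \<le> 2 * (M 0 + B) * (k + 1)"
        using True step[of 0] by (simp add: algebra_simps of_nat_diff)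
      finally show ?thesis by simp
    next
      case False
      have b: "\<bar>b k\<bar> \<le> 2 * (M 0 + B)" using step[of k] False by simp
      then have "2 * (M 0 + B) * 1 \<le> 2 * (M 0 + B) * (k + 1)"
        by (intro mult_left_mono) auto
      with b show ?thesis by simp
    qed
  qed
  then show ?thesis using q by (simp add: b_def field_simps)
qed

subsection \<open>Bernstein's inequality on the real line\<close>

text \<open>Phragmen-Lindelof argument: in the closed upper half-plane the divisor
  \<open>1 - \<i> * \<epsilon> * w\<close> has modulus at least 1 and at least
  \<open>\<epsilon> * norm w\<close>. So the quotient is at most 1 on the real line and on large
  arcs; then \<open>\<epsilon>\<close> tends to 0.\<close>

lemma half_plane_maximum_principle:
  assumes hol: "g holomorphic_on UNIV"
    and bdd: "\<And>w. 0 \<le> Im w \<Longrightarrow> norm (g w) \<le> C"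
    and real: "\<And>x. norm (g (of_real x)) \<le> 1"
    and w: "0 < Im w"
  shows "norm (g w) \<le> 1"
proof -
  have main: "norm (g w) \<le> norm (1 - \<i> * of_real \<epsilon> * w)" if \<epsilon>: "0 < \<epsilon>" for \<epsilon>
  proof -
    define d where "d w = 1 - \<i> * of_real \<epsilon> * w" for w
    \<comment> \<open>The first entry puts \<open>w\<close> inside the half-disc, the second makes
      the quotient at most 1 on the arc.\<close>
    define R where "R = max (norm w + 1) (C / \<epsilon>)"
    define S where "S = {w. 0 < Im w} \<inter> ball 0 R"
    have d1: "1 \<le> norm (d w)" if "0 \<le> Im w" for w
    proof -
      have "1 \<le> Re (d w)" using \<epsilon> that by (simp add: d_def)
      then show ?thesis using abs_Re_le_cmod[of "d w"] by linarith
    qed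
    have d2: "\<epsilon> * norm w \<le> norm (d w)" if "0 \<le> Im w" for w
    proof (rule power2_le_imp_le)
      have "(norm (d w))\<^sup>2 = (1 + \<epsilon> * Im w)\<^sup>2 + (\<epsilon> * Re w)\<^sup>2"
        by (simp add: cmod_power2 d_def)
      moreover have "(\<epsilon> * norm w)\<^sup>2 = (\<epsilon> * Im w)\<^sup>2 + (\<epsilon> * Re w)\<^sup>2"
        by (simp add: cmod_power2 power_mult_distrib distrib_left)
      moreover have "(\<epsilon> * Im w)\<^sup>2 \<le> (1 + \<epsilon> * Im w)\<^sup>2"
        using \<epsilon> that by (intro power_mono) auto
      ultimately show "(\<epsilon> * norm w)\<^sup>2 \<le> (norm (d w))\<^sup>2" by linarith
    qed simp
    have d0: "d w \<noteq> 0" if "0 \<le> Im w" for w using d1[OF that] by auto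
    have opS: "open S" unfolding S_def by (intro open_Int open_halfspace_Im_gt open_ball)
    have clS: "closure S \<subseteq> {w. 0 \<le> Im w} \<inter> cball 0 R"
      unfolding S_def
      by (rule closure_minimal) (auto intro: closed_Int closed_halfspace_Im_ge)
    have holf: "(\<lambda>w. g w / d w) holomorphic_on {w. 0 \<le> Im w}"
      using d0 holomorphic_on_subset[OF hol, of "{w. 0 \<le> Im w}"]
      by (intro holomorphic_on_divide) (auto simp: d_def intro!: holomorphic_intros)
    have "norm (g w / d w) \<le> 1"
    proof (rule maximum_modulus_frontier[of "\<lambda>w. g w / d w" S])
      show "(\<lambda>w. g w / d w) holomorphic_on interior S"
        unfolding interior_open[OF opS] by (intro holomorphic_on_subset[OF holf]) (auto simp: S_def)
      show "continuous_on (closure S) (\<lambda>w. g w / d w)"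
        using clS by (intro holomorphic_on_imp_continuous_on holomorphic_on_subset[OF holf]) auto
      show "bounded S" unfolding S_def by (rule bounded_subset[OF bounded_ball[of 0 R]]) auto
      show "w \<in> S" using w by (simp add: S_def R_def)
      fix z assume "z \<in> frontier S"
      then have z: "0 \<le> Im z" "norm z \<le> R" "z \<notin> S"
        using opS clS by (auto simp: frontier_def interior_open)
      show "norm (g z / d z) \<le> 1"
      proof (cases "Im z = 0")
        case True
        then have "norm (g z) \<le> 1" using real[of "Re z"] by (simp add: complex_is_Real_iff)
        then show ?thesis using d1[OF z(1)] by (simp add: norm_divide divide_le_eq_1)
      next
        case False
        then have "norm z = R" using z by (auto simp: S_def)
        then have "C \<le> \<epsilon> * norm z" using \<epsilon> by (simp add: R_def field_simps max_def)
        then show ?thesis using bdd[OF z(1)] d2[OF z(1)] d1[OF z(1)]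
          by (simp add: norm_divide divide_le_eq_1)
      qed
    qed
    then have "norm (g w) \<le> norm (d w)"
      using d0[of w] w by (simp add: norm_divide divide_le_eq_1)
    then show ?thesis by (simp add: d_def)
  qed
  have "((\<lambda>\<epsilon>. norm (1 - \<i> * of_real \<epsilon> * w)) \<longlongrightarrow> norm (1 - \<i> * of_real 0 * w)) (at_right 0)"
    by (intro tendsto_intros)
  then have "norm (g w) \<le> norm (1 - \<i> * of_real 0 * w)"
    by (rule tendsto_lowerbound[OF _ eventually_mono[OF eventually_at_right_less[of 0] main]]) simp_all
  then show ?thesis by simp
qed

section \<open>Chebyshev polynomials and the growth of entire functions\<close>

fun chebyshev :: "nat \<Rightarrow> complex \<Rightarrow> complex" where
  "chebyshev 0 z = 1"
| "chebyshev (Suc 0) z = z"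
| "chebyshev (Suc (Suc n)) z = 2 * z * chebyshev (Suc n) z - chebyshev n z"

lemma chebyshev_cos: "chebyshev n (cos s) = cos (of_nat n * s)"
proof (induction n "cos s" rule: chebyshev.induct)
  case (3 n)
  have "cos (of_nat (Suc (Suc n)) * s) + cos (of_nat n * s) = 2 * cos s * cos (of_nat (Suc n) * s)"
    using cos_add[of "of_nat (Suc n) * s" s] cos_diff[of "of_nat (Suc n) * s" s]
    by (simp add: algebra_simps)
  then show ?case using 3 by (simp add: algebra_simps)
qed auto

text \<open>A crude bound is enough, since it only has to give boundedness in the half-plane. What
  matters is the exponent \<open>n\<close>, which matches the decay of the exponential factor used
  there.\<close>

lemma norm_chebyshev_le: "norm (chebyshev n z) \<le> (1 + 2 * norm z) ^ n"
proof (induction n z rule: chebyshev.induct)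
  case (3 n z)
  have "norm (chebyshev (Suc (Suc n)) z)
      \<le> 2 * norm z * norm (chebyshev (Suc n) z) + norm (chebyshev n z)"
    using norm_triangle_ineq4[of "2 * z * chebyshev (Suc n) z" "chebyshev n z"]
    by (simp add: norm_mult)
  also have "\<dots> \<le> 2 * norm z * (1 + 2 * norm z) ^ Suc n + (1 + 2 * norm z) ^ n"
    using 3 by (intro add_mono mult_left_mono) auto
  also have "\<dots> \<le> 2 * norm z * (1 + 2 * norm z) ^ Suc n + (1 + 2 * norm z) ^ Suc n"
    by (intro add_mono order_refl power_increasing) auto
  also have "\<dots> = (1 + 2 * norm z) ^ Suc (Suc n)" by (simp add: algebra_simps)
  finally show ?case .
qed auto

lemma holomorphic_on_chebyshev [holomorphic_intros]:
  assumes "h holomorphic_on S"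
  shows "(\<lambda>w. chebyshev n (h w)) holomorphic_on S"
proof -
  have "(\<lambda>w. chebyshev n (h w)) holomorphic_on S \<and> (\<lambda>w. chebyshev (Suc n) (h w)) holomorphic_on S"
    by (induction n) (auto intro!: holomorphic_intros assms)
  then show ?thesis ..
qed

text \<open>The constant \<open>C\<close> disappears because the maximum principle is applied to all the
  functions \<open>T\<^sub>n \<circ> h\<close>, \<open>T\<^sub>n\<close> the Chebyshev polynomials. If \<open>h (\<i>y) = cos s\<close> then
  \<open>T\<^sub>n (h (\<i>y)) = cos (n s)\<close> grows like \<open>exp (n \<bar>Im s\<bar>)\<close>, which gives \<open>\<bar>Im s\<bar> \<le> q y\<close>.\<close>

lemma Im_entire_le_sinh:
  assumes hol: "h holomorphic_on UNIV"
    and growth: "\<And>w. norm (h w) \<le> C * exp (q * \<bar>Im w\<bar>)" and q: "0 \<le> q"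
    and real: "\<And>x. h (of_real x) = of_real (F x)" and F: "\<And>x. \<bar>F x\<bar> \<le> 1"
    and y: "0 < y"
  shows "\<bar>Im (h (\<i> * of_real y))\<bar> \<le> sinh (q * y)"
proof -
  have C: "0 \<le> C" using order_trans[OF norm_ge_zero growth[of 0]] by simp
  have cheb: "norm (chebyshev n (h (\<i> * of_real y))) \<le> exp (n * (q * y))" for n
  proof -
    \<comment> \<open>This factor has modulus 1 on the real line, and its decay
      \<open>exp (- (n * q * Im w))\<close> cancels the growth of
      \<open>chebyshev n (h w)\<close>.\<close>
    define e where "e w = exp (\<i> * of_real (n * q) * w)" for w
    have norm_e: "norm (e w) = exp (- (n * q * Im w))" for w
      by (simp add: e_def norm_exp_eq_Re)
    have "norm (chebyshev n (h (\<i> * of_real y)) * e (\<i> * of_real y)) \<le> 1"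
    proof (rule half_plane_maximum_principle[where g = "\<lambda>w. chebyshev n (h w) * e w"])
      show "(\<lambda>w. chebyshev n (h w) * e w) holomorphic_on UNIV"
        unfolding e_def by (intro holomorphic_intros hol)
      show "norm (chebyshev n (h w) * e w) \<le> (1 + 2 * C) ^ n" if w: "0 \<le> Im w" for w
      proof -
        have "1 + 2 * norm (h w) \<le> exp (q * Im w) + 2 * (C * exp (q * Im w))"
          using growth[of w] q w by (intro add_mono mult_left_mono) auto
        also have "\<dots> = (1 + 2 * C) * exp (q * Im w)" by (simp add: algebra_simps)
        finally have "norm (chebyshev n (h w)) \<le> ((1 + 2 * C) * exp (q * Im w)) ^ n"
          by (intro order_trans[OF norm_chebyshev_le] power_mono) auto
        also have "\<dots> = (1 + 2 * C) ^ n * exp (n * q * Im w)"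
          by (simp add: power_mult_distrib exp_of_nat_mult[symmetric] mult_ac)
        finally show ?thesis
          by (simp add: norm_mult norm_e exp_minus field_simps)
      qed
      show "norm (chebyshev n (h (of_real x)) * e (of_real x)) \<le> 1" for x
      proof -
        have "h (of_real x) = cos (of_real (arccos (F x)))"
          using F[of x] by (simp add: real cos_of_real abs_le_iff)
        then have "chebyshev n (h (of_real x)) = of_real (cos (n * arccos (F x)))"
          by (simp add: chebyshev_cos cos_of_real[symmetric])
        then have "norm (chebyshev n (h (of_real x))) \<le> 1" by (simp only: norm_of_real abs_cos_le_one)
        then show ?thesis by (simp add: norm_mult norm_e)
      qed
    qed (use y in simp)
    then show ?thesis
      by (simp add: norm_mult norm_e exp_minus field_simps)
  qed
  define s where "s = Arccos (h (\<i> * of_real y))"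
  have s: "cos s = h (\<i> * of_real y)" by (simp add: s_def)
  define b where "b = \<bar>Im s\<bar>"
  \<comment> \<open>The right side does not depend on \<open>n\<close>, so \<open>b - q * y\<close>
    cannot be positive. The 3 arises from \<open>exp (n * b) - 1 \<le> 2 * exp (n * (q * y))\<close>
    together with \<open>1 \<le> exp (n * (q * y))\<close>.\<close>
  have exp_b: "n * (b - q * y) \<le> ln 3" for n :: nat
  proof -
    have "exp (n * b) - 1 \<le> 2 * norm (cos (of_nat n * s))"
    proof -
      define v where "v = of_nat n * s"
      have v: "\<bar>Im v\<bar> = n * b" by (simp add: v_def b_def abs_mult)
      have "exp \<bar>Im v\<bar> - exp (- \<bar>Im v\<bar>) \<le> norm (exp (\<i> * v) + exp (- (\<i> * v)))"
        using norm_diff_ineq[of "exp (\<i> * v)" "exp (- (\<i> * v))"]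
          norm_diff_ineq[of "exp (- (\<i> * v))" "exp (\<i> * v)"]
        by (auto simp: norm_exp_eq_Re abs_if add.commute)
      also have "\<dots> = 2 * norm (cos v)"
        by (simp add: cos_exp_eq norm_divide)
      finally show ?thesis unfolding v v_def[symmetric]
        using b_def by (smt (verit) exp_le_one_iff mult_nonneg_nonneg of_nat_0_le_iff abs_ge_zero)
    qed
    also have "\<dots> \<le> 2 * exp (n * (q * y))"
      using cheb[of n] by (simp add: s[symmetric] chebyshev_cos)
    finally have "exp (n * b) \<le> 3 * exp (n * (q * y))"
      using q y by (smt (verit) one_le_exp_iff mult_nonneg_nonneg of_nat_0_le_iff)
    then have "exp (n * b - n * (q * y)) \<le> exp (ln 3)"
      by (simp add: exp_diff field_simps)
    then show ?thesis by (simp only: exp_le_cancel_iff right_diff_distrib)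
  qed
  have "b \<le> q * y"
  proof (rule ccontr)
    assume "\<not> b \<le> q * y"
    then obtain n :: nat where "ln 3 < n * (b - q * y)"
      using ex_less_of_nat_mult[of "b - q * y" "ln 3"] by auto
    with exp_b[of n] show False by simp
  qed
  have "\<bar>Im (cos s)\<bar> = \<bar>sin (Re s)\<bar> * sinh b"
  proof -
    have "Im (cos s) = - (sin (Re s) * sinh (Im s))"
      by (simp add: Im_cos sinh_def field_simps)
    then show ?thesis by (simp add: b_def abs_mult)
  qed
  also have "\<dots> \<le> 1 * sinh b"
    by (intro mult_right_mono) (auto simp: b_def)
  also have "\<dots> \<le> sinh (q * y)" using \<open>b \<le> q * y\<close> by simp
  finally show ?thesis by (simp add: s)
qed

text \<open>The Taylor series at every real centre \<open>x\<close> converges everywhere with bound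
  \<open>K * exp (q * norm z)\<close>, and by the identity theorem all of them represent one entire
  function. Expanding at \<open>Re w\<close> leaves only \<open>Im w\<close> in the
  exponent.\<close>

lemma entire_extension:
  fixes F :: "nat \<Rightarrow> real \<Rightarrow> real"
  assumes deriv: "\<And>k x. (F k has_real_derivative F (Suc k) x) (at x)"
    and bdd: "\<And>k x. \<bar>F k x\<bar> \<le> K * q ^ k" and q: "0 < q"
  obtains h where "h holomorphic_on UNIV" "\<And>x. h (of_real x) = of_real (F 0 x)"
    "\<And>w. norm (h w) \<le> K * exp (q * \<bar>Im w\<bar>)"
    "(h has_field_derivative of_real (F (Suc 0) 0)) (at 0)"
proof -
  define c where "c x k = complex_of_real (F k x) / fact k" for x k
  define h where "h x z = (\<Sum>k. c x k * z ^ k)" for x z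
  have term_le: "norm (c x k * z ^ k) \<le> K * ((q * norm z) ^ k /\<^sub>R fact k)" for x k z
  proof -
    have "norm (c x k * z ^ k) = \<bar>F k x\<bar> * (norm z ^ k / fact k)"
      by (simp add: c_def norm_mult norm_divide norm_power)
    also have "\<dots> \<le> K * q ^ k * (norm z ^ k / fact k)"
      by (intro mult_right_mono bdd) auto
    finally show ?thesis by (simp add: power_mult_distrib field_simps)
  qed
  have esum: "(\<lambda>k. K * ((q * r) ^ k /\<^sub>R fact k)) sums (K * exp (q * r))" for r
    by (intro sums_mult exp_converges)
  have nsum: "summable (\<lambda>k. norm (c x k * z ^ k))" for x z
    by (rule summable_comparison_test'[OF sums_summable[OF esum]]) (use term_le in simp)
  have summ: "summable (\<lambda>k. c x k * z ^ k)" for x z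
    by (rule summable_norm_cancel[OF nsum])
  have bound: "norm (h x z) \<le> K * exp (q * norm z)" for x z
    unfolding h_def
    by (rule norm_suminf_le[OF term_le, THEN order_trans])
       (use esum[of "norm z"] in \<open>auto simp: sums_iff\<close>)
  have dh: "(h x has_field_derivative (\<Sum>k. diffs (c x) k * z ^ k)) (at z)" for x z
    unfolding h_def by (rule termdiffs_strong_converges_everywhere) (rule summ)
  have hol: "h x holomorphic_on UNIV" for x
    using dh by (auto simp: holomorphic_on_def field_differentiable_def)
  have hreal: "h x (of_real t) = of_real (F 0 (x + t))" for x t
  proof -
    \<comment> \<open>The Lagrange remainder is dominated by a term of the exponential series for
      \<open>q * \<bar>t\<bar>\<close>.\<close>
    have "(\<lambda>n. F 0 (x + t) - (\<Sum>k<n. F k x / fact k * t ^ k)) \<longlonglongrightarrow> 0"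
    proof (rule Lim_null_comparison)
      show "\<forall>\<^sub>F n in sequentially. norm (F 0 (x + t) - (\<Sum>k<n. F k x / fact k * t ^ k))
          \<le> K * ((q * \<bar>t\<bar>) ^ n /\<^sub>R fact n)"
      proof (intro always_eventually allI)
        fix n
        have "((\<lambda>u. F k (x + u)) has_real_derivative F (Suc k) (x + u)) (at u)" for k u
          using DERIV_shift[of "F k" "F (Suc k) (x + u)" u x] deriv[of k "x + u"]
          by (simp add: add.commute)
        then have "\<forall>k u. ((\<lambda>u. F k (x + u)) has_real_derivative F (Suc k) (x + u)) (at u)"
          by blast
        from Maclaurin_all_le[of "\<lambda>k u. F k (x + u)", OF refl this, of t n]
        obtain u where u: "F 0 (x + t) = (\<Sum>k<n. F k x / fact k * t ^ k) + F n (x + u) / fact n * t ^ n"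
          by auto
        have "norm (F 0 (x + t) - (\<Sum>k<n. F k x / fact k * t ^ k)) = \<bar>F n (x + u)\<bar> * (\<bar>t\<bar> ^ n / fact n)"
          by (simp add: u abs_mult power_abs)
        also have "\<dots> \<le> K * q ^ n * (\<bar>t\<bar> ^ n / fact n)"
          by (intro mult_right_mono bdd) auto
        finally show "norm (F 0 (x + t) - (\<Sum>k<n. F k x / fact k * t ^ k))
          \<le> K * ((q * \<bar>t\<bar>) ^ n /\<^sub>R fact n)"
          by (simp add: power_mult_distrib field_simps)
      qed
      show "(\<lambda>n. K * ((q * \<bar>t\<bar>) ^ n /\<^sub>R fact n)) \<longlonglongrightarrow> 0"
        by (rule summable_LIMSEQ_zero[OF sums_summable[OF esum]])
    qed
    then have "(\<lambda>n. F 0 (x + t) - (F 0 (x + t) - (\<Sum>k<n. F k x / fact k * t ^ k)))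
        \<longlonglongrightarrow> F 0 (x + t) - 0"
      by (intro tendsto_intros)
    then have "(\<lambda>k. F k x / fact k * t ^ k) sums F 0 (x + t)"
      by (simp add: sums_def)
    from sums_of_real[OF this, where 'a = complex] show ?thesis
      unfolding h_def c_def by (simp add: sums_iff)
  qed
  have shift: "h x z = h 0 (of_real x + z)" for x z
  proof -
    have "h x z - h 0 (of_real x + z) = 0"
    proof (rule analytic_continuation[of "\<lambda>z. h x z - h 0 (of_real x + z)" UNIV "range of_real" 0])
      show "(\<lambda>z. h x z - h 0 (of_real x + z)) holomorphic_on UNIV"
        by (intro holomorphic_intros hol holomorphic_on_compose_gen[of _ _ "h 0" UNIV, unfolded o_def]) auto
      show "(0::complex) islimpt range of_real"
        unfolding islimpt_approachable
      proof (intro allI impI)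
        fix e :: real assume "0 < e"
        then show "\<exists>x'\<in>range complex_of_real. x' \<noteq> 0 \<and> dist x' 0 < e"
          by (intro bexI[OF _ rangeI[of _ "e / 2"]]) auto
      qed
      show "h x z - h 0 (of_real x + z) = 0" if "z \<in> range of_real" for z
        using that hreal[of x] hreal[of 0] by (auto simp flip: of_real_add)
    qed auto
    then show ?thesis by simp
  qed
  show ?thesis
  proof (rule that)
    show "h 0 holomorphic_on UNIV" by (rule hol)
    show "h 0 (of_real x) = of_real (F 0 x)" for x using hreal[of 0 x] by simp
    show "norm (h 0 w) \<le> K * exp (q * \<bar>Im w\<bar>)" for w
    proof -
      have "h 0 w = h (Re w) (\<i> * of_real (Im w))"
        unfolding shift[of "Re w"] by (subst complex_eq[of w]) simp
      then show ?thesis using bound[of "Re w" "\<i> * of_real (Im w)"] by (simp add: norm_mult)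
    qed
    have "(\<Sum>k. diffs (c 0) k * 0 ^ k) = of_real (F (Suc 0) 0)"
      by (subst powser_zero) (simp add: diffs_def c_def)
    then show "(h 0 has_field_derivative of_real (F (Suc 0) 0)) (at 0)"
      using dh[of 0 0] by simp
  qed
qed

lemma Bernstein_inequality_real:
  fixes F :: "nat \<Rightarrow> real \<Rightarrow> real"
  assumes deriv: "\<And>k x. (F k has_real_derivative F (Suc k) x) (at x)"
    and bdd: "\<And>k x. \<bar>F k x\<bar> \<le> M k" and F0: "\<And>x. \<bar>F 0 x\<bar> \<le> 1"
    and q: "0 < q" and sparse: "\<exists>\<^sub>F m in sequentially. M m \<le> B * q ^ m"
  shows "F (Suc 0) 0 \<le> q"
proof (rule dense_ge)
  fix r assume r: "q < r"
  define d where "d = r / q - 1"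
  have d: "0 < d" "r = (1 + d) * q" using r q by (auto simp: d_def field_simps)
  define L where "L = 2 * (M 0 + B)"
  have bd: "\<bar>F k x\<bar> \<le> L * (k + 1) * q ^ k" for k x
    unfolding L_def by (rule derivative_bound_of_sparse[OF deriv bdd q sparse])
  have L: "0 \<le> L" using order_trans[OF abs_ge_zero bd[of 0 0]] by simp
  have "\<bar>F k x\<bar> \<le> L * (1 + 1 / d) * r ^ k" for k x
  proof -
    \<comment> \<open>Bernoulli's inequality absorbs the linear factor \<open>k + 1\<close> into the
      passage from \<open>q\<close> to \<open>r = (1 + d) * q\<close>.\<close>
    have "real k + 1 \<le> (1 + 1 / d) * (1 + k * d)"
      using d(1) by (simp add: field_simps)
    also have "\<dots> \<le> (1 + 1 / d) * (1 + d) ^ k"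
      using d(1) Bernoulli_inequality[of d k] by (intro mult_left_mono) auto
    finally have "L * (k + 1) * q ^ k \<le> L * ((1 + 1 / d) * (1 + d) ^ k) * q ^ k"
      using L q by (intro mult_right_mono mult_left_mono) auto
    also have "\<dots> = L * (1 + 1 / d) * r ^ k"
      by (simp add: d(2) power_mult_distrib)
    finally show ?thesis using bd[of k x] by simp
  qed
  from entire_extension[OF deriv this] r q obtain h where h: "h holomorphic_on UNIV"
    "\<And>x. h (of_real x) = of_real (F 0 x)"
    "\<And>w. norm (h w) \<le> L * (1 + 1 / d) * exp (r * \<bar>Im w\<bar>)"
    "(h has_field_derivative of_real (F (Suc 0) 0)) (at 0)"
    by (metis order_less_trans)
  \<comment> \<open>As \<open>u\<close> vanishes at 0 and is nonnegative to the right of it, its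
    derivative \<open>r - F (Suc 0) 0\<close> at 0 cannot be negative.\<close>
  define u where "u y = sinh (r * y) - Im (h (\<i> * of_real y))" for y
  have u: "0 \<le> u y" if "0 < y" for y
    using Im_entire_le_sinh[OF h(1,3) _ h(2) F0 that] r q by (simp add: u_def abs_le_iff)
  have "((\<lambda>y. h (\<i> * of_real y)) has_vector_derivative \<i> * of_real (F (Suc 0) 0)) (at 0)"
  proof (rule has_vector_derivative_real_field)
    have "((\<lambda>z. \<i> * z) has_field_derivative \<i>) (at (of_real 0))"
      by (auto intro!: derivative_eq_intros)
    from DERIV_chain2[OF _ this, of h "of_real (F (Suc 0) 0)"] h(4)
    show "((\<lambda>z. h (\<i> * z)) has_field_derivative \<i> * of_real (F (Suc 0) 0)) (at (of_real 0))"
      by (simp add: mult.commute[of \<i> "of_real _"])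
  qed
  then have Im_h: "((\<lambda>y. Im (h (\<i> * of_real y))) has_real_derivative F (Suc 0) 0) (at 0)"
    using has_field_derivative_Im by fastforce
  have "((\<lambda>y. sinh (r * y)) has_real_derivative r) (at 0)"
    by (auto intro!: derivative_eq_intros)
  from DERIV_diff[OF this Im_h] have "(u has_real_derivative r - F (Suc 0) 0) (at 0)"
    by (simp add: u_def[abs_def])
  moreover have "u 0 = 0" using h(2)[of 0] by (simp add: u_def)
  ultimately have "\<not> r - F (Suc 0) 0 < 0"
    using DERIV_neg_dec_right[of u "r - F (Suc 0) 0" 0] u
    by (metis add_0 field_lbound_gt_zero not_le zero_less_one)
  then show "F (Suc 0) 0 \<le> r" by simp
qed

subsection \<open>Isometry groups\<close>

lemma isometry_group_linear:
  assumes "strongly_continuous_isometry_group T"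
  shows "T t (x - y) = T t x - T t y" and "T t (r *\<^sub>R x) = r *\<^sub>R T t x"
proof -
  from assms have "Vector_Spaces.linear scaleC scaleC (T t)"
    by (simp add: strongly_continuous_isometry_group_def)
  then interpret module_hom scaleC scaleC "T t"
    by (simp add: Vector_Spaces.linear_def module_hom_def vector_space_def module_def)
  show "T t (x - y) = T t x - T t y" by (rule diff)
  show "T t (r *\<^sub>R x) = r *\<^sub>R T t x" by (simp add: scaleR_scaleC scale)
qed

text \<open>By the group law the difference quotient at \<open>t\<close> is the image under
  \<open>T t\<close> of the one at 0, and \<open>T t\<close> preserves the norm of the
  error.\<close>

lemma isometry_group_has_vector_derivative:
  assumes T: "strongly_continuous_isometry_group T" and D: "is_generator T A D" and x: "x \<in> A"
  shows "((\<lambda>t. T t x) has_vector_derivative T t (D x)) (at t)"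
proof -
  note lin = isometry_group_linear[OF T]
  have iso: "norm (T t y) = norm y" and add: "T (t + h) y = T t (T h y)" for h y
    using T by (auto simp: strongly_continuous_isometry_group_def)
  have "((\<lambda>h. (T h x - x) /\<^sub>R h - D x) \<longlongrightarrow> D x - D x) (at 0)"
    using D x by (intro tendsto_intros) (auto simp: is_generator_def)
  then have "((\<lambda>h. norm ((T h x - x) /\<^sub>R h - D x)) \<longlongrightarrow> 0) (at 0)"
    by (simp add: tendsto_norm_zero)
  moreover have "\<forall>\<^sub>F h in at 0. norm ((T h x - x) /\<^sub>R h - D x) =
      norm (T (t + h) x - T t x - h *\<^sub>R T t (D x)) / norm h"
  proof (rule eventually_mono[OF eventually_neq_at_within[of 0]])
    fix h :: real assume h: "h \<noteq> 0"
    have "T (t + h) x - T t x - h *\<^sub>R T t (D x) = T t (h *\<^sub>R ((T h x - x) /\<^sub>R h - D x))"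
      using h by (simp add: add lin scaleR_diff_right)
    then show "norm ((T h x - x) /\<^sub>R h - D x) = norm (T (t + h) x - T t x - h *\<^sub>R T t (D x)) / norm h"
      using h by (simp add: iso)
  qed
  ultimately have "((\<lambda>h. norm (T (t + h) x - T t x - h *\<^sub>R T t (D x)) / norm h) \<longlongrightarrow> 0) (at 0)"
    by (rule Lim_transform_eventually)
  then show ?thesis
    by (simp add: has_vector_derivative_def has_derivative_at bounded_linear_scaleR_left)
qed

text \<open>\<open>power_domain A D k\<close> constrains exactly the iterates of order below
  \<open>k\<close>, so letting \<open>k\<close> run through all positive numbers reaches every
  order, including 0.\<close>

lemma smooth_domain_iff: "f \<in> smooth_domain A D \<longleftrightarrow> (\<forall>k. (D ^^ k) f \<in> A)"
proof -
  have pd: "f \<in> power_domain A D k \<longleftrightarrow> (\<forall>j<k. (D ^^ j) f \<in> A)" for k f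
  proof (induction k arbitrary: f)
    case (Suc k)
    have "(\<forall>j<Suc k. (D ^^ j) f \<in> A) \<longleftrightarrow> f \<in> A \<and> (\<forall>j<k. (D ^^ j) (D f) \<in> A)"
      by (simp add: All_less_Suc2 funpow_swap1)
    then show ?case by (simp add: Suc)
  qed simp
  show ?thesis
    by (auto simp: smooth_domain_def pd)
qed

lemma Bernstein_inequality_generator:
  assumes T: "strongly_continuous_isometry_group T" and D: "is_generator T A D"
    and f: "\<And>k. (D ^^ k) f \<in> A" and q: "0 < q"
    and sparse: "\<exists>\<^sub>F m in sequentially. norm ((D ^^ m) f) \<le> B * q ^ m"
  shows "norm (D f) \<le> q * norm f"
proof (cases "f = 0")
  case True
  \<comment> \<open>Division by \<open>norm f\<close> is impossible here; \<open>D 0 = 0\<close> is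
    read off from the difference quotients, which all vanish.\<close>
  have "T t 0 = 0" for t
    using T by (metis norm_eq_zero strongly_continuous_isometry_group_def)
  moreover have "((\<lambda>t. (T t f - f) /\<^sub>R t) \<longlongrightarrow> D f) (at 0)"
    using D f[of 0] by (simp add: is_generator_def)
  ultimately have "D f = 0"
    using True by (simp add: tendsto_const_iff)
  with True show ?thesis by simp
next
  case False
  \<comment> \<open>The functional norms \<open>D f\<close> rather than \<open>f\<close>, so that
    \<open>F (Suc 0) 0\<close> becomes \<open>norm (D f) / norm f\<close>.\<close>
  obtain \<phi> where \<phi>: "bounded_linear \<phi>" "\<And>x. \<bar>\<phi> x\<bar> \<le> norm x" "\<phi> (D f) = norm (D f)"
    using norming_functional by metis
  have iso: "norm (T t y) = norm y" and T0: "T 0 y = y" for t y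
    using T by (auto simp: strongly_continuous_isometry_group_def)
  define F where "F k t = \<phi> (T t ((D ^^ k) f)) / norm f" for k t
  define M where "M k = norm ((D ^^ k) f) / norm f" for k
  have "F (Suc 0) 0 \<le> q"
  proof (rule Bernstein_inequality_real)
    show "(F k has_real_derivative F (Suc k) x) (at x)" for k x
    proof -
      have "((\<lambda>t. \<phi> (T t ((D ^^ k) f))) has_real_derivative \<phi> (T x ((D ^^ Suc k) f))) (at x)"
        using bounded_linear.has_vector_derivative[OF \<phi>(1)
            isometry_group_has_vector_derivative[OF T D f[of k]]]
        by (simp add: has_real_derivative_iff_has_vector_derivative)
      then show ?thesis unfolding F_def by (rule DERIV_cdivide)
    qed
    show bdd: "\<bar>F k x\<bar> \<le> M k" for k x
      using \<phi>(2)[of "T x ((D ^^ k) f)"] by (simp add: F_def M_def iso divide_right_mono)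
    show "\<bar>F 0 x\<bar> \<le> 1" for x
      using bdd[of 0 x] False by (simp add: M_def)
    show "\<exists>\<^sub>F m in sequentially. M m \<le> B / norm f * q ^ m"
      using sparse False by (simp add: M_def field_simps)
  qed (rule q)
  then show ?thesis using False by (simp add: F_def T0 \<phi>(3) field_simps)
qed

text \<open>The one-step inequality applies to every \<open>(D ^^ k) f\<close>: the sparse bound at
  order \<open>m + k\<close> is a sparse bound for it at order \<open>m\<close>, with constant
  \<open>q ^ k\<close>.\<close>

lemma Bernstein_inequality_iterate:
  assumes T: "strongly_continuous_isometry_group T" and D: "is_generator T A D"
    and f: "f \<in> smooth_domain A D" and q: "0 < q"
    and sparse: "\<exists>\<^sub>F m in sequentially. norm ((D ^^ m) f) \<le> q ^ m"
  shows "norm ((D ^^ k) f) \<le> q ^ k * norm f"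
proof (induction k)
  case (Suc k)
  have comp: "(D ^^ j) ((D ^^ k) f) = (D ^^ (j + k)) f" for j
    by (simp add: funpow_add)
  have "norm (D ((D ^^ k) f)) \<le> q * norm ((D ^^ k) f)"
  proof (rule Bernstein_inequality_generator[OF T D _ q])
    show "(D ^^ j) ((D ^^ k) f) \<in> A" for j
      using f by (simp add: smooth_domain_iff comp)
    show "\<exists>\<^sub>F m in sequentially. norm ((D ^^ m) ((D ^^ k) f)) \<le> q ^ k * q ^ m"
      unfolding frequently_sequentially
    proof
      fix N
      obtain n where "N + k \<le> n" "norm ((D ^^ n) f) \<le> q ^ n"
        using sparse unfolding frequently_sequentially by blast
      then show "\<exists>m\<ge>N. norm ((D ^^ m) ((D ^^ k) f)) \<le> q ^ k * q ^ m"
        by (intro exI[of _ "n - k"]) (simp add: comp flip: power_add)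
    qed
  qed
  also have "\<dots> \<le> q * (q ^ k * norm f)"
    using q Suc by (intro mult_left_mono) auto
  finally show ?case by simp
qed simp

section \<open>Limits of roots and the Bernstein exponent\<close>

lemma root_limit_of_sparse_criterion:
  fixes M :: "nat \<Rightarrow> real"
  assumes nonneg: "\<And>k. 0 \<le> M k"
    and crit: "\<And>q k. 0 < q \<Longrightarrow> \<exists>\<^sub>F m in sequentially. M m \<le> q ^ m \<Longrightarrow> M k \<le> q ^ k * M 0"
    and bound: "0 \<le> \<sigma>" "\<And>k. M k \<le> \<sigma> ^ k * M 0"
  obtains d where "0 \<le> d" "(\<lambda>k. root k (M k)) \<longlonglongrightarrow> d" "\<And>k. M k \<le> d ^ k * M 0"
    "\<And>r. 0 \<le> r \<Longrightarrow> (\<And>k. M k \<le> r ^ k * M 0) \<Longrightarrow> d \<le> r"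
proof (cases "M 0 = 0")
  case True
  then have "M k = 0" for k using bound(2)[of k] nonneg[of k] by simp
  then show ?thesis by (intro that[of 0]) auto
next
  case False
  then have M0: "0 < M 0" using nonneg[of 0] by simp
  \<comment> \<open>The infimum of \<open>S\<close> is the lower limit of the roots. By
    \<open>crit\<close> every element of \<open>S\<close> bounds all \<open>M k\<close>, which
    forces the upper limit down to the same value.\<close>
  define S where "S = {q. 0 < q \<and> (\<exists>\<^sub>F m in sequentially. M m \<le> q ^ m)}"
  \<comment> \<open>For \<open>q > r\<close> the powers of \<open>r / q\<close> eventually absorb
    the factor \<open>M 0\<close>. This shows that \<open>S\<close> is nonempty and, later, that
    \<open>d\<close> is the least bound.\<close>
  have S_above: "q \<in> S" if r: "0 \<le> r" "\<And>k. M k \<le> r ^ k * M 0" and q: "r < q" for q r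
  proof -
    have "(\<lambda>m. (r / q) ^ m * M 0) \<longlonglongrightarrow> 0 * M 0"
      using r(1) q by (intro tendsto_intros LIMSEQ_power_zero) auto
    then have "\<forall>\<^sub>F m in sequentially. (r / q) ^ m * M 0 < 1"
      by (rule order_tendstoD) simp
    then have "\<forall>\<^sub>F m in sequentially. M m \<le> q ^ m"
    proof (rule eventually_mono)
      fix m assume "(r / q) ^ m * M 0 < 1"
      then have "r ^ m * M 0 < q ^ m" using r(1) q by (simp add: power_divide field_simps)
      then show "M m \<le> q ^ m" using r(2)[of m] by simp
    qed
    then show ?thesis using r(1) q by (auto simp: S_def intro: eventually_frequently)
  qed
  have ne: "S \<noteq> {}" using S_above[OF bound, of "\<sigma> + 1"] by auto
  have bdd: "bdd_below S" by (intro bdd_belowI[of _ 0]) (auto simp: S_def)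
  define d where "d = Inf S"
  have d0: "0 \<le> d" unfolding d_def using ne by (intro cInf_greatest) (auto simp: S_def)
  have Md: "M k \<le> d ^ k * M 0" for k
  proof -
    have "((\<lambda>q. q ^ k * M 0) \<longlongrightarrow> d ^ k * M 0) (at_right d)"
      by (intro tendsto_intros)
    moreover have "M k \<le> q ^ k * M 0" if "d < q" for q
    proof -
      obtain s where s: "s \<in> S" "s < q"
        using \<open>d < q\<close> cInf_lessD[OF ne, of q] unfolding d_def by blast
      then have "M k \<le> s ^ k * M 0" using crit by (auto simp: S_def)
      also have "\<dots> \<le> q ^ k * M 0"
        using s M0 by (intro mult_right_mono power_mono) (auto simp: S_def)
      finally show ?thesis .
    qed
    then have "\<forall>\<^sub>F q in at_right d. M k \<le> q ^ k * M 0"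
      by (intro eventually_mono[OF eventually_at_right_less])
    ultimately show ?thesis by (rule tendsto_lowerbound) simp
  qed
  have lim: "(\<lambda>k. root k (M k)) \<longlonglongrightarrow> d"
  proof (rule order_tendstoI)
    fix a assume a: "a < d"
    show "\<forall>\<^sub>F k in sequentially. a < root k (M k)"
    proof (cases "0 \<le> a")
      case True
      define q where "q = (a + d) / 2"
      have q: "0 < q" "a < q" "q < d" using a True by (auto simp: q_def)
      have "q \<notin> S" using q(3) cInf_lower[OF _ bdd, of q] unfolding d_def by (meson not_le)
      then have "\<forall>\<^sub>F m in sequentially. q ^ m < M m"
        using q(1) by (auto simp: S_def frequently_def not_le)
      \<comment> \<open>Index 0 is discarded because \<open>root 0\<close> is constantly 0.\<close>
      with eventually_gt_at_top[of 0] show ?thesis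
      proof eventually_elim
        case (elim k)
        then have "root k (q ^ k) < root k (M k)" by simp
        then show ?case using elim q by (simp add: real_root_power_cancel)
      qed
    next
      case False
      with nonneg have "a < root k (M k)" for k
        using real_root_ge_zero[of "M k" k] by simp
      then show ?thesis by simp
    qed
  next
    fix a assume a: "d < a"
    have "(\<lambda>k. d * root k (M 0)) \<longlonglongrightarrow> d * 1"
      by (intro tendsto_intros LIMSEQ_root_const M0)
    then have "\<forall>\<^sub>F k in sequentially. d * root k (M 0) < a"
      using a by (intro order_tendstoD) auto
    with eventually_gt_at_top[of 0] show "\<forall>\<^sub>F k in sequentially. root k (M k) < a"
    proof eventually_elim
      case (elim k)
      have "root k (M k) \<le> root k (d ^ k * M 0)" using elim Md[of k] by simp
      also have "\<dots> = d * root k (M 0)"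
        using elim d0 by (simp add: real_root_mult real_root_power_cancel)
      finally show ?case using elim by simp
    qed
  qed
  show ?thesis
  proof (rule that[OF d0 lim Md])
    fix r :: real assume r: "0 \<le> r" "\<And>k. M k \<le> r ^ k * M 0"
    have "d \<le> q" if "r < q" for q
      unfolding d_def by (rule cInf_lower[OF S_above[OF r that] bdd])
    then show "d \<le> r" by (rule dense_ge)
  qed
qed

lemma bernstein_set_iff:
  "f \<in> bernstein_set A D \<sigma> \<longleftrightarrow> f \<in> smooth_domain A D \<and> (\<forall>k. norm ((D ^^ k) f) \<le> \<sigma> ^ k * norm f)"
proof -
  have "(\<forall>k\<ge>1. norm ((D ^^ k) f) \<le> \<sigma> ^ k * norm f) \<longleftrightarrow> (\<forall>k. norm ((D ^^ k) f) \<le> \<sigma> ^ k * norm f)"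
    by (metis funpow_0 less_one linorder_not_less mult_1 order_refl power_0)
  then show ?thesis by (simp add: bernstein_set_def)
qed

lemma bernstein_exponent_eq:
  assumes "0 \<le> d" "f \<in> bernstein_set A D d"
    and "\<And>r. 0 \<le> r \<Longrightarrow> f \<in> bernstein_set A D r \<Longrightarrow> d \<le> r"
  shows "bernstein_exponent A D f = ereal d"
proof -
  have "(LEAST s. 0 \<le> s \<and> f \<in> bernstein_set A D s) = d"
    by (rule Least_equality) (use assms in auto)
  then show ?thesis using assms unfolding bernstein_exponent_def Let_def by auto
qed

theorem theorem7p8:
  fixes T :: "real \<Rightarrow> 'a::complex_banach \<Rightarrow> 'a"
    and A :: "'a set" and D :: "'a \<Rightarrow> 'a"
  assumes "strongly_continuous_isometry_group T"
    and "is_generator T A D"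
  shows "(\<forall>(f::'a) (\<sigma>::real). 0 < \<sigma> \<and> f \<in> bernstein_set A D \<sigma> \<longrightarrow>
            (\<exists>d::real. (\<lambda>k. root k (norm ((D ^^ k) f))) \<longlonglongrightarrow> d \<and>
                       ereal d = bernstein_exponent A D f)) \<and>
         (\<forall>(f::'a) (d::real). f \<in> smooth_domain A D \<and>
            (\<lambda>k. root k (norm ((D ^^ k) f))) \<longlonglongrightarrow> d \<longrightarrow>
            f \<in> bernstein_set A D d \<and> ereal d = bernstein_exponent A D f)"
proof -
  note iterate = Bernstein_inequality_iterate[OF assms]
  have limit: "\<exists>d. (\<lambda>k. root k (norm ((D ^^ k) f))) \<longlonglongrightarrow> d \<and> f \<in> bernstein_set A D d \<and>
      ereal d = bernstein_exponent A D f"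
    if \<sigma>: "0 < \<sigma>" and f: "f \<in> bernstein_set A D \<sigma>" for f \<sigma>
  proof -
    define M where "M k = norm ((D ^^ k) f)" for k
    have smooth: "f \<in> smooth_domain A D" using f by (simp add: bernstein_set_iff)
    have bern: "f \<in> bernstein_set A D r \<longleftrightarrow> (\<forall>k. M k \<le> r ^ k * M 0)" for r
      using smooth by (simp add: bernstein_set_iff M_def)
    obtain d where d: "0 \<le> d" "(\<lambda>k. root k (M k)) \<longlonglongrightarrow> d" "\<And>k. M k \<le> d ^ k * M 0"
      "\<And>r. 0 \<le> r \<Longrightarrow> (\<And>k. M k \<le> r ^ k * M 0) \<Longrightarrow> d \<le> r"
    proof (rule root_limit_of_sparse_criterion)
      show "M k \<le> q ^ k * M 0" if "0 < q" "\<exists>\<^sub>F m in sequentially. M m \<le> q ^ m" for q k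
        using iterate[OF smooth that[unfolded M_def]] by (simp add: M_def)
      show "M k \<le> \<sigma> ^ k * M 0" for k using f bern by blast
    qed (use \<sigma> in \<open>auto simp: M_def\<close>)
    have "bernstein_exponent A D f = ereal d"
      by (rule bernstein_exponent_eq) (use d bern in auto)
    with d(2,3) bern show ?thesis by (auto simp: M_def)
  qed
  have converse: "f \<in> bernstein_set A D d \<and> ereal d = bernstein_exponent A D f"
    if f: "f \<in> smooth_domain A D" and lim: "(\<lambda>k. root k (norm ((D ^^ k) f))) \<longlonglongrightarrow> d" for f d
  proof -
    have d: "0 \<le> d" by (rule LIMSEQ_le_const[OF lim]) (intro exI allI impI real_root_ge_zero norm_ge_zero)
    \<comment> \<open>Any number above \<open>d\<close> would serve in place of
      \<open>d + 1\<close>. It gives some Bernstein bound, so \<open>limit\<close> applies, and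
      uniqueness of limits identifies \<open>d'\<close> with \<open>d\<close>.\<close>
    have "\<forall>\<^sub>F k in sequentially. root k (norm ((D ^^ k) f)) < d + 1"
      using lim by (rule order_tendstoD) simp
    with eventually_gt_at_top[of 0]
    have "\<forall>\<^sub>F k in sequentially. norm ((D ^^ k) f) \<le> (d + 1) ^ k"
    proof eventually_elim
      case (elim k)
      have "norm ((D ^^ k) f) = root k (norm ((D ^^ k) f)) ^ k" using elim by simp
      also have "\<dots> \<le> (d + 1) ^ k" using elim by (intro power_mono) auto
      finally show ?case .
    qed
    then have "f \<in> bernstein_set A D (d + 1)"
      using iterate[OF f, of "d + 1"] d f by (simp add: bernstein_set_iff eventually_frequently)
    with limit[of "d + 1" f] d obtain d' where "(\<lambda>k. root k (norm ((D ^^ k) f))) \<longlonglongrightarrow> d'"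
      "f \<in> bernstein_set A D d'" "ereal d' = bernstein_exponent A D f" by auto
    with LIMSEQ_unique[OF lim] show ?thesis by auto
  qed
  show ?thesis using limit converse by blast
qed

end
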